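(* Let $\hat{\mathbf x}_1,\hat{\mathbf x}_2,\hat{\mathbf x}_3,\hat{\mathbf x}_4$ be four finite points of $\mathrm P\mathbb R^2$ and $\mathbf l$ a line of $\mathrm P\mathbb R^2$ such that the four points and the line are in general position. Then the problem of determining a non-degenerate conic $\mathbf C$ such that $\hat{\mathbf x}_i^T\mathbf C\hat{\mathbf x}_i=0$ for $i=1,2,3,4$ and $\mathbf l^T\mathbf C^{-1}\mathbf l=0$ has two distinct real solutions if and only if $\mathbf l$ passes through none of $\hat{\mathbf x}_1,\hat{\mathbf x}_2,\hat{\mathbf x}_3,\hat{\mathbf x}_4$ and none of the three vertices of the diagonal triangle of the quadrangle $\hat{\mathbf x}_1\hat{\mathbf x}_2\hat{\mathbf x}_3\hat{\mathbf x}_4$, and furthermore one of the following conditions holds: (i) either all of $\det([\hat{\mathbf x}_{123}])$, $\det([\hat{\mathbf x}_{124}])$, $\det([\hat{\mathbf x}_{134}])$, $\det([\hat{\mathbf x}_{234}])$ have the same direction, or some two of them are clockwise and the remaining two are anticlockwise; and, in addition, either all four points lie on the same side of $\mathbf l$, or some two of the points lie on one side of $\mathbf l$ and the remaining two lie on the other side; (ii) some three of $\det([\hat{\mathbf x}_{123}])$, $\det([\hat{\mathbf x}_{124}])$, $\det([\hat{\mathbf x}_{134}])$, $\det([\hat{\mathbf x}_{234}])$ have the same direction and the remaining one has the opposite direction; and, in addition, some three of the points lie on the same side of $\mathbf l$ and the remaining one lies on the other side.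
   Context: $\mathrm P\mathbb R^2$ is the real projective plane. A hat denotes a finite point in normalized homogeneous coordinates, i.e. a vector of $\mathbb R^3$ whose third component is $1$. A line is given by a nonzero vector $\mathbf l\in\mathbb R^3$ (up to scale), and $\mathbf x$ lies on $\mathbf l$ iff $\mathbf x^T\mathbf l=0$. The vertices of the diagonal triangle are $\boldsymbol\xi_1=(\hat{\mathbf x}_1\times\hat{\mathbf x}_2)\times(\hat{\mathbf x}_3\times\hat{\mathbf x}_4)$, $\boldsymbol\xi_2=(\hat{\mathbf x}_1\times\hat{\mathbf x}_3)\times(\hat{\mathbf x}_2\times\hat{\mathbf x}_4)$, $\boldsymbol\xi_3=(\hat{\mathbf x}_1\times\hat{\mathbf x}_4)\times(\hat{\mathbf x}_2\times\hat{\mathbf x}_3)$, where $\times$ is the cross product. Four points and one line are in general position if no three of the points are collinear, $\mathbf l$ is not a side or diagonal line of the quadrangle (i.e. not one of the six lines joining two of the four points), and $\mathbf l$ is not a side of the diagonal triangle (i.e. not one of the three lines joining two of $\boldsymbol\xi_1,\boldsymbol\xi_2,\boldsymbol\xi_3$). $[\hat{\mathbf x}_{ijk}]$ is the $3\times 3$ matrix with columns $\hat{\mathbf x}_i,\hat{\mathbf x}_j,\hat{\mathbf x}_k$. For non-collinear finite points, $\det([\hat{\mathbf x}_{ijk}])$ is called clockwise if the movement $\hat{\mathbf x}_i\to\hat{\mathbf x}_j\to\hat{\mathbf x}_k$ is clockwise (equivalently, the determinant is negative) and anticlockwise otherwise (equivalently, the determinant is positive); this is its "direction". Two finite points $\hat{\mathbf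 x},\hat{\mathbf y}$ not on $\mathbf l$ lie on the same side of $\mathbf l$ iff $\hat{\mathbf x}^T\mathbf l$ and $\hat{\mathbf y}^T\mathbf l$ have the same sign, and on different sides otherwise. A conic is a nonzero symmetric $3\times3$ matrix (complex entries allowed) up to nonzero scale; it is non-degenerate if its determinant is nonzero and real if it can be represented by a real matrix. Solutions are counted up to scale. *)

theory Defs
  imports "HOL-Analysis.Analysis"
begin

text \<open>A quadrangle is given by \<^term>\<open>x :: nat \<Rightarrow> real^3\<close>, of which only the values at the indices
  1, 2, 3, 4 are used.\<close>

section \<open>Points and lines\<close>

definition finite_point :: "real^3 \<Rightarrow> bool" where
  "finite_point p \<longleftrightarrow> p $ 3 = 1"

definition lies_on :: "real^3 \<Rightarrow> real^3 \<Rightarrow> bool" where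
  "lies_on p l \<longleftrightarrow> p \<bullet> l = 0"

definition same_line :: "real^3 \<Rightarrow> real^3 \<Rightarrow> bool" where
  "same_line l m \<longleftrightarrow> (\<exists>k. k \<noteq> 0 \<and> m = k *\<^sub>R l)"

text \<open>Two coinciding points are projectively collinear with every third point.\<close>

definition proj_collinear :: "real^3 \<Rightarrow> real^3 \<Rightarrow> real^3 \<Rightarrow> bool" where
  "proj_collinear p q r \<longleftrightarrow> (\<exists>m. m \<noteq> 0 \<and> lies_on p m \<and> lies_on q m \<and> lies_on r m)"

definition diag_vertex :: "(nat \<Rightarrow> real^3) \<Rightarrow> nat \<Rightarrow> real^3" where
  "diag_vertex x k =
    (if k = 1 then cross3 (cross3 (x 1) (x 2)) (cross3 (x 3) (x 4))
     else if k = 2 then cross3 (cross3 (x 1) (x 3)) (cross3 (x 2) (x 4))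
     else cross3 (cross3 (x 1) (x 4)) (cross3 (x 2) (x 3)))"

definition general_position :: "(nat \<Rightarrow> real^3) \<Rightarrow> real^3 \<Rightarrow> bool" where
  "general_position x l \<longleftrightarrow>
    (\<forall>i\<in>{1..4}. \<forall>j\<in>{1..4}. \<forall>k\<in>{1..4}. i < j \<and> j < k \<longrightarrow> \<not> proj_collinear (x i) (x j) (x k)) \<and>
    (\<forall>i\<in>{1..4}. \<forall>j\<in>{1..4}. i < j \<longrightarrow> \<not> same_line l (cross3 (x i) (x j))) \<and>
    (\<forall>i\<in>{1..3}. \<forall>j\<in>{1..3}. i < j \<longrightarrow> \<not> same_line l (cross3 (diag_vertex x i) (diag_vertex x j)))"

section \<open>Directions and sides\<close>

datatype direction = Clockwise | Anticlockwise

definition column_matrix :: "real^3 \<Rightarrow> real^3 \<Rightarrow> real^3 \<Rightarrow> real^3^3" where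
  "column_matrix p q r = transpose (vector [p, q, r])"

definition triples :: "(nat \<times> nat \<times> nat) set" where
  "triples = {(1, 2, 3), (1, 2, 4), (1, 3, 4), (2, 3, 4)}"

fun dir :: "(nat \<Rightarrow> real^3) \<Rightarrow> nat \<times> nat \<times> nat \<Rightarrow> direction" where
  "dir x (i, j, k) =
    (if det (column_matrix (x i) (x j) (x k)) < 0 then Clockwise else Anticlockwise)"

text \<open>Meaningful as the side of a finite point only if the point is not on the line.\<close>

definition side :: "real^3 \<Rightarrow> real^3 \<Rightarrow> real" where
  "side l p = sgn (p \<bullet> l)"

definition all_agree :: "('i \<Rightarrow> 'b) \<Rightarrow> 'i set \<Rightarrow> bool" where
  "all_agree f I \<longleftrightarrow> (\<forall>i\<in>I. \<forall>j\<in>I. f i = f j)"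

definition splits :: "nat \<Rightarrow> nat \<Rightarrow> ('i \<Rightarrow> 'b) \<Rightarrow> 'i set \<Rightarrow> bool" where
  "splits a b f I \<longleftrightarrow>
    (\<exists>A B. A \<union> B = I \<and> A \<inter> B = {} \<and> card A = a \<and> card B = b \<and>
       all_agree f A \<and> all_agree f B \<and> (\<forall>i\<in>A. \<forall>j\<in>B. f i \<noteq> f j))"

section \<open>Conics\<close>

definition cvec :: "real^3 \<Rightarrow> complex^3" where
  "cvec p = (\<chi> i. complex_of_real (p $ i))"

definition cmat :: "real^3^3 \<Rightarrow> complex^3^3" where
  "cmat A = map_matrix complex_of_real A"

definition conic_matrix :: "complex^3^3 \<Rightarrow> bool" where
  "conic_matrix C \<longleftrightarrow> transpose C = C \<and> C \<noteq> 0"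

definition scale_rel :: "((complex^3^3) \<times> (complex^3^3)) set" where
  "scale_rel = {(A, B). \<exists>k. k \<noteq> 0 \<and> B = map_matrix ((*) k) A}"

lemma equiv_scale_rel: "equiv UNIV scale_rel"
proof (rule equivI)
  show "scale_rel \<subseteq> UNIV \<times> UNIV" by simp
  show "refl scale_rel"
    unfolding refl_on_def scale_rel_def
    by (auto simp: vec_eq_iff intro!: exI[of _ 1])
  show "sym scale_rel"
  proof (rule symI)
    fix A B assume "(A, B) \<in> scale_rel"
    then obtain k where "k \<noteq> 0" "B = map_matrix ((*) k) A"
      by (auto simp: scale_rel_def)
    then show "(B, A) \<in> scale_rel"
      by (auto simp: scale_rel_def vec_eq_iff intro!: exI[of _ "inverse k"])
  qed
  show "trans scale_rel"
  proof (rule transI)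
    fix A B C assume "(A, B) \<in> scale_rel" "(B, C) \<in> scale_rel"
    then obtain k m where "k \<noteq> 0" "B = map_matrix ((*) k) A" "m \<noteq> 0" "C = map_matrix ((*) m) B"
      by (auto simp: scale_rel_def)
    then show "(A, C) \<in> scale_rel"
      by (auto simp: scale_rel_def vec_eq_iff intro!: exI[of _ "m * k"])
  qed
qed

text \<open>The product \<^const>\<open>scalar_product\<close> is bilinear, without complex conjugation.\<close>

definition solution_matrices :: "(nat \<Rightarrow> real^3) \<Rightarrow> real^3 \<Rightarrow> (complex^3^3) set" where
  "solution_matrices x l =
    {C. conic_matrix C \<and> det C \<noteq> 0 \<and>
        (\<forall>i\<in>{1..4}. scalar_product (cvec (x i)) (C *v cvec (x i)) = 0) \<and>
        scalar_product (cvec l) (matrix_inv C *v cvec l) = 0}"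

definition solutions :: "(nat \<Rightarrow> real^3) \<Rightarrow> real^3 \<Rightarrow> (complex^3^3) set set" where
  "solutions x l = solution_matrices x l // scale_rel"

definition real_conic :: "(complex^3^3) set \<Rightarrow> bool" where
  "real_conic K \<longleftrightarrow> (\<exists>A. cmat A \<in> K)"

end

theory Submission
  imports Defs
begin

text \<open>
  The four points form a projective frame.  As no three of them are collinear,
  \<open>x\<^sub>4 = a x\<^sub>1 + b x\<^sub>2 + c x\<^sub>3\<close> with nonzero \<open>a, b, c\<close>, and the matrix \<open>M\<close> with columns
  \<open>a x\<^sub>1, b x\<^sub>2, c x\<^sub>3\<close> carries the unit vectors and \<open>(1,1,1)\<close> to multiples of the four points.
  Replacing \<open>C\<close> by \<open>M\<^sup>T C M\<close> and \<open>l\<close> by \<open>w = M\<^sup>T l\<close> preserves all conditions.  A conic passes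
  through the reference points iff its diagonal vanishes and its off-diagonal entries
  \<open>u\<close> (position 2,3), \<open>v\<close> (1,3), \<open>u'\<close> (1,2) add up to \<open>0\<close>.  Its determinant is \<open>2 u v u'\<close>, so a
  nondegenerate conic can be scaled to \<open>u = 1\<close> and is given by a single parameter
  \<open>t = v\<close>, different from \<open>0\<close> and \<open>-1\<close> (lemma \<open>frame_conic_complete\<close>).

  With the adjugate in place of the inverse, tangency to the line \<open>w = (p, q, r)\<close> becomes the
  quadratic equation
  \<open>(p + r)\<^sup>2 - 2 (p q - r (p + q + r)) t + (q + r)\<^sup>2 t\<^sup>2 = 0\<close>
  (lemma \<open>frame_tangency\<close>), whose discriminant is \<open>-16 p q r (p + q + r)\<close>.  Hence two real
  solutions are equivalent to \<open>p q r (p + q + r) < 0\<close>, provided that neither root is one of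
  the degenerate parameters and that the leading coefficient does not vanish.  The values of the
  quadratic at \<open>0\<close> and \<open>-1\<close> and its leading coefficient are \<open>(p + r)\<^sup>2\<close>, \<open>(p + q)\<^sup>2\<close> and
  \<open>(q + r)\<^sup>2\<close>, and one of these vanishes exactly when \<open>l\<close> passes through a vertex of the
  diagonal triangle (lemmas \<open>card_tangency_params\<close> and \<open>diag_vertex_combination\<close>).

  By Cramer's rule \<open>a b c\<close> has the sign opposite to that of the product of the four
  determinants.  Since \<open>p q r (p + q + r)\<close> is \<open>a b c\<close> times the product of the four numbers
  \<open>x\<^sub>i \<bullet> l\<close>, the discriminant is positive iff the product of the determinants and the product of
  the \<open>x\<^sub>i \<bullet> l\<close> have the same nonzero sign.  The sign of a product of four nonzero numbers is the
  parity of the number of negative factors: patterns 4+0 and 2+2 make it positive, pattern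
  3+1 negative (lemma \<open>sign_pattern_iff\<close>).
\<close>

section \<open>Inverses and congruence of matrices\<close>

lemma matrix_inv_cancel:
  fixes A :: "'a::semiring_1^'n^'n"
  assumes "invertible A"
  shows "A ** matrix_inv A = mat 1" and "matrix_inv A ** A = mat 1"
proof -
  have "A ** matrix_inv A = mat 1 \<and> matrix_inv A ** A = mat 1"
    using assms unfolding invertible_def matrix_inv_def by (rule someI_ex)
  then show "A ** matrix_inv A = mat 1" "matrix_inv A ** A = mat 1" by auto
qed

lemma matrix_inv_eqI:
  fixes A B :: "'a::field^'n^'n"
  assumes "A ** B = mat 1"
  shows "matrix_inv A = B"
proof -
  have "invertible A"
    using assms matrix_left_right_inverse unfolding invertible_def by blast
  then have "matrix_inv A ** (A ** B) = B"
    by (simp add: matrix_mul_assoc matrix_inv_cancel)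
  then show ?thesis using assms by simp
qed

text \<open>Congruence acts on inverses contragrediently; this is why a line has to be transformed by
  \<^term>\<open>transpose M\<close> when conics are pulled back along \<^term>\<open>M\<close>.\<close>

lemma matrix_inv_congruent:
  fixes A M :: "'a::field^'n^'n"
  assumes "invertible M" "invertible A"
  shows "matrix_inv A = M ** matrix_inv (transpose M ** A ** M) ** transpose M"
proof (rule matrix_inv_eqI)
  let ?B = "transpose M ** A ** M" and ?N = "matrix_inv M"
  have MN: "M ** ?N = mat 1" using assms matrix_inv_cancel by blast
  have T: "transpose ?N ** transpose M = mat 1"
    using MN by (metis matrix_transpose_mul transpose_mat)
  have B: "invertible ?B"
    by (intro invertible_mult assms)
      (use assms(1) in \<open>simp add: invertible_det_nz\<close>)
  have "A ** M = transpose ?N ** ?B"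
    by (simp add: matrix_mul_assoc T)
  then have "A ** (M ** matrix_inv ?B ** transpose M)
      = transpose ?N ** (?B ** matrix_inv ?B) ** transpose M"
    by (simp add: matrix_mul_assoc)
  then show "A ** (M ** matrix_inv ?B ** transpose M) = mat 1"
    using B T by (simp add: matrix_inv_cancel)
qed

lemma congruent_eq_iff:
  fixes A M :: "'a::field^'n^'n"
  assumes "invertible M"
  shows "transpose M ** A ** M = B \<longleftrightarrow> A = transpose (matrix_inv M) ** B ** matrix_inv M"
proof -
  let ?N = "matrix_inv M"
  have MN: "M ** ?N = mat 1" "?N ** M = mat 1" using assms matrix_inv_cancel by blast+
  have T: "transpose ?N ** transpose M = mat 1" "transpose M ** transpose ?N = mat 1"
    using MN by (metis matrix_transpose_mul transpose_mat)+
  show ?thesis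
  proof
    assume "transpose M ** A ** M = B"
    then have "transpose ?N ** B ** ?N = (transpose ?N ** transpose M) ** A ** (M ** ?N)"
      by (auto simp: matrix_mul_assoc)
    then show "A = transpose ?N ** B ** ?N" using MN T by simp
  next
    assume "A = transpose ?N ** B ** ?N"
    then have "transpose M ** A ** M = (transpose M ** transpose ?N) ** B ** (?N ** M)"
      by (auto simp: matrix_mul_assoc)
    then show "transpose M ** A ** M = B" using MN T by simp
  qed
qed

section \<open>Reduction to real matrices\<close>

lemma cmat_mult: "cmat A ** cmat B = cmat (A ** B)"
  by (simp add: cmat_def vec_eq_iff matrix_matrix_mult_def)

lemma cmat_mat_1: "cmat (mat 1) = mat 1"
  by (simp add: cmat_def vec_eq_iff mat_def)

lemma cmat_mv: "cmat A *v cvec p = cvec (A *v p)"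
  by (simp add: cmat_def cvec_def vec_eq_iff matrix_vector_mult_def)

lemma cvec_dot: "scalar_product (cvec p) (cvec q) = complex_of_real (p \<bullet> q)"
  by (simp add: scalar_product_def cvec_def inner_vec_def)

lemma det_cmat: "det (cmat A) = complex_of_real (det A)"
  by (simp add: det_3 cmat_def)

lemma cmat_eq: "cmat A = cmat B \<longleftrightarrow> A = B"
  by (simp add: cmat_def vec_eq_iff)

lemma cmat_transpose: "transpose (cmat A) = cmat (transpose A)"
  by (simp add: cmat_def vec_eq_iff transpose_def)

definition tangent_real_conic :: "(nat \<Rightarrow> real^3) \<Rightarrow> real^3 \<Rightarrow> real^3^3 \<Rightarrow> bool" where
  "tangent_real_conic x l A \<longleftrightarrow> transpose A = A \<and> det A \<noteq> 0 \<and>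
     (\<forall>i\<in>{1..4}. x i \<bullet> (A *v x i) = 0) \<and> l \<bullet> (matrix_inv A *v l) = 0"

lemma cmat_solution: "cmat A \<in> solution_matrices x l \<longleftrightarrow> tangent_real_conic x l A"
proof (cases "det A = 0")
  case True
  then show ?thesis by (simp add: solution_matrices_def tangent_real_conic_def det_cmat)
next
  case False
  then have "invertible A" by (simp add: invertible_det_nz)
  then have "matrix_inv (cmat A) = cmat (matrix_inv A)"
    by (intro matrix_inv_eqI) (simp add: cmat_mult matrix_inv_cancel cmat_mat_1)
  moreover have "cmat A \<noteq> 0"
  proof
    assume "cmat A = 0"
    then have "A = 0" by (simp add: cmat_def vec_eq_iff)
    then show False using False by (simp add: det_3)
  qed
  ultimately show ?thesis using False
    by (simp add: solution_matrices_def tangent_real_conic_def conic_matrix_def det_cmat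
      cmat_transpose cmat_eq cmat_mv cvec_dot)
qed

text \<open>Needed because a real conic is a class containing some real matrix, which may differ by a
  complex factor from the matrix by which the class is presented.\<close>

lemma solution_matrices_scale:
  assumes C: "C \<in> solution_matrices x l" and k: "k \<noteq> 0"
  shows "map_matrix ((*) k) C \<in> solution_matrices x l"
proof -
  let ?S = "\<lambda>k. map_matrix ((*) k) :: complex^3^3 \<Rightarrow> complex^3^3"
  have "invertible C" using C by (simp add: solution_matrices_def invertible_det_nz)
  then have "C ** matrix_inv C = mat 1" by (rule matrix_inv_cancel)
  moreover have "?S k C ** ?S (1/k) D = C ** D" for D
    using k by (simp add: vec_eq_iff matrix_matrix_mult_def)
  ultimately have inv: "matrix_inv (?S k C) = ?S (1/k) (matrix_inv C)"
    by (intro matrix_inv_eqI) simp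
  have form: "scalar_product p (?S c D *v q) = c * scalar_product p (D *v q)" for p q c D
    by (simp add: scalar_product_def matrix_vector_mult_def sum_distrib_left mult_ac)
  have "det (?S k C) = k^3 * det C" by (simp add: det_3 algebra_simps power3_eq_cube)
  moreover have "transpose (?S k C) = ?S k (transpose C)" by (simp add: vec_eq_iff transpose_def)
  ultimately show ?thesis
    using C k by (auto simp: solution_matrices_def conic_matrix_def inv form vec_eq_iff)
qed

lemma real_solutions:
  "{K \<in> solutions x l. real_conic K}
    = (\<lambda>A. scale_rel `` {cmat A}) ` {A. tangent_real_conic x l A}" (is "?L = ?R")
proof (intro equalityI subsetI)
  fix K assume "K \<in> ?L"
  then obtain C A where C: "C \<in> solution_matrices x l" "K = scale_rel `` {C}" and A: "cmat A \<in> K"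
    unfolding solutions_def real_conic_def by (auto elim: quotientE)
  then have rel: "(C, cmat A) \<in> scale_rel" by simp
  then obtain k where "k \<noteq> 0" "cmat A = map_matrix ((*) k) C" by (auto simp: scale_rel_def)
  then have "tangent_real_conic x l A"
    using C solution_matrices_scale cmat_solution by metis
  moreover have "K = scale_rel `` {cmat A}"
    using C rel equiv_class_eq[OF equiv_scale_rel] by simp
  ultimately show "K \<in> ?R" by blast
next
  fix K assume "K \<in> ?R"
  then obtain A where A: "K = scale_rel `` {cmat A}" "cmat A \<in> solution_matrices x l"
    by (auto simp: cmat_solution)
  then have "cmat A \<in> K" using equiv_class_self[OF equiv_scale_rel] by simp
  with A show "K \<in> ?L" unfolding solutions_def real_conic_def by (auto intro: quotientI)
qed

section \<open>The conics through the reference points of a frame\<close>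

text \<open>The frame consists of the unit vectors and \<open>(1,1,1)\<close>.  The parameter is the slope of the
  pencil: the three degenerate members, which are the line pairs through the frame, sit at
  \<open>t = 0\<close>, \<open>t = -1\<close> and \<open>t = \<infinity>\<close>.\<close>

definition frame_conic :: "real \<Rightarrow> real^3^3" where
  "frame_conic t = vector [vector [0, - 1 - t, t], vector [- 1 - t, 0, 1], vector [t, 1, 0]]"

lemma det_frame_conic: "det (frame_conic t) = - 2 * t * (1 + t)"
  by (simp add: frame_conic_def det_3 algebra_simps)

text \<open>Passing through the unit vectors kills the diagonal, and passing through \<open>(1,1,1)\<close> makes the
  remaining three entries add up to \<open>0\<close>; as the determinant is twice their product, the entry at
  position (2,3) can serve as the scaling factor.\<close>

lemma frame_conic_complete:
  fixes B :: "real^3^3"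
  assumes "transpose B = B" "det B \<noteq> 0" "\<And>i. B $ i $ i = 0" "vector [1,1,1] \<bullet> (B *v vector [1,1,1]) = 0"
  obtains u t where "u \<noteq> 0" "B = u *\<^sub>R frame_conic t"
proof -
  define a b c where abc: "a = B $ 2 $ 3" "b = B $ 1 $ 3" "c = B $ 1 $ 2"
  have sym: "B $ i $ j = B $ j $ i" for i j
  proof -
    have "transpose B $ j $ i = B $ j $ i" using assms(1) by simp
    then show ?thesis by (simp add: transpose_def)
  qed
  have B: "B $ 1 $ 1 = 0" "B $ 2 $ 2 = 0" "B $ 3 $ 3 = 0"
      "B $ 1 $ 2 = c" "B $ 2 $ 1 = c" "B $ 1 $ 3 = b" "B $ 3 $ 1 = b" "B $ 2 $ 3 = a" "B $ 3 $ 2 = a"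
    using assms(3) sym[of 2 1] sym[of 3 1] sym[of 3 2] by (auto simp: abc)
  have c: "c = - a - b"
    using assms(4) by (simp add: inner_vec_def sum_3 matrix_vector_mult_def B)
  have "det B = 2 * (a * b * c)"
    by (simp add: det_3 B)
  with assms(2) have u: "a \<noteq> 0" by auto
  have "B = a *\<^sub>R frame_conic (b / a)"
    using u by (simp add: vec_eq_iff forall_3 frame_conic_def B c field_simps)
  with u that show ?thesis by blast
qed

text \<open>Up to sign, the value at \<open>c\<close> of the quadratic form given by the adjugate of
  \<open>frame_conic t\<close>.\<close>

definition tangency_poly :: "real^3 \<Rightarrow> real \<Rightarrow> real" where
  "tangency_poly c t = (c$1 + c$3)\<^sup>2 - 2 * (c$1 * c$2 - c$3 * (c$1 + c$2 + c$3)) * t + (c$2 + c$3)\<^sup>2 * t\<^sup>2"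

lemma frame_tangency:
  assumes "u \<noteq> 0" "t \<noteq> 0" "t \<noteq> - 1"
  shows "c \<bullet> (matrix_inv (u *\<^sub>R frame_conic t) *v c) = 0 \<longleftrightarrow> tangency_poly c t = 0"
proof -
  define d where "d = - 2 * t * (1 + t)"
  have d: "d \<noteq> 0" using assms by (auto simp: d_def)
  \<comment> \<open>the adjugate of \<^term>\<open>frame_conic t\<close>, whose determinant is \<^term>\<open>d\<close>\<close>
  define J :: "real^3^3" where "J = vector [vector [-1, t, - 1 - t],
     vector [t, - t\<^sup>2, - t * (1 + t)], vector [- 1 - t, - t * (1 + t), - (1 + t)\<^sup>2]]"
  have "(u *\<^sub>R frame_conic t) ** ((1 / (u * d)) *\<^sub>R J) = (1 / d) *\<^sub>R (frame_conic t ** J)"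
    using assms by (simp add: vec_eq_iff matrix_matrix_mult_def sum_distrib_left)
  also have "frame_conic t ** J = d *\<^sub>R mat 1"
    by (simp add: vec_eq_iff forall_3 matrix_matrix_mult_def sum_3 frame_conic_def J_def d_def
      mat_def power2_eq_square algebra_simps)
  finally have "matrix_inv (u *\<^sub>R frame_conic t) = (1 / (u * d)) *\<^sub>R J"
    using d by (intro matrix_inv_eqI) simp
  moreover have "c \<bullet> (J *v c) = - tangency_poly c t"
    by (simp add: inner_vec_def matrix_vector_mult_def sum_3 J_def tangency_poly_def
      power2_eq_square algebra_simps)
  ultimately show ?thesis using assms d by (simp add: scaleR_matrix_vector_assoc[symmetric])
qed

definition pencil :: "real^3^3 \<Rightarrow> real \<Rightarrow> real^3^3" where
  "pencil M t = transpose (matrix_inv M) ** frame_conic t ** matrix_inv M"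

text \<open>The roots at the degenerate parameters \<open>0\<close> and \<open>-1\<close> correspond to line pairs and are
  discarded.\<close>

definition tangency_params :: "real^3 \<Rightarrow> real set" where
  "tangency_params c = {t. t \<noteq> 0 \<and> t \<noteq> - 1 \<and> tangency_poly c t = 0}"

lemma adjoint_dot:
  fixes M :: "real^'n^'m"
  shows "(M *v v) \<bullet> w = v \<bullet> (transpose M *v w)"
  by (metis dot_lmul_matrix vector_transpose_matrix)

lemma axis_form:
  fixes B :: "real^'n^'n"
  shows "axis i 1 \<bullet> (B *v axis i 1) = B $ i $ i"
  by (simp add: inner_axis' matrix_vector_mult_basis column_def)

text \<open>The frame \<open>M\<close> sends the reference points to multiples of the given points, so
  \<open>M\<^sup>T A M\<close> passes through the reference points iff \<open>A\<close> passes through the given ones, and it is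
  tangent to \<open>M\<^sup>T l\<close> iff \<open>A\<close> is tangent to \<open>l\<close>.\<close>

lemma tangent_real_conic_iff:
  assumes M: "invertible M"
    and a: "a1 \<noteq> 0" "a2 \<noteq> 0" "a3 \<noteq> 0"
    and x: "M *v axis 1 1 = a1 *\<^sub>R x 1" "M *v axis 2 1 = a2 *\<^sub>R x 2" "M *v axis 3 1 = a3 *\<^sub>R x 3"
      "M *v vector [1, 1, 1] = x 4"
  shows "tangent_real_conic x l A \<longleftrightarrow>
    (\<exists>u t. u \<noteq> 0 \<and> t \<in> tangency_params (transpose M *v l) \<and> A = u *\<^sub>R pencil M t)"
proof -
  define B where "B = transpose M ** A ** M"
  let ?N = "matrix_inv M"
  let ?c = "transpose M *v l"
  have A: "A = transpose ?N ** B ** ?N"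
    using congruent_eq_iff[OF M] B_def by blast
  have form: "(M *v v) \<bullet> (A *v (M *v v)) = v \<bullet> (B *v v)" for v
    by (simp add: adjoint_dot B_def matrix_vector_mul_assoc matrix_mul_assoc)
  have sym: "transpose A = A \<longleftrightarrow> transpose B = B"
  proof
    assume "transpose A = A"
    then show "transpose B = B" by (simp add: B_def matrix_transpose_mul matrix_mul_assoc)
  next
    assume "transpose B = B"
    then show "transpose A = A" by (simp add: A matrix_transpose_mul matrix_mul_assoc)
  qed
  have dM: "det M \<noteq> 0" using M by (simp add: invertible_det_nz)
  have det: "det A = 0 \<longleftrightarrow> det B = 0" using dM by (simp add: B_def det_mul)
  have points: "(\<forall>i\<in>{1..4}. x i \<bullet> (A *v x i) = 0) \<longleftrightarrow>
      (\<forall>i. B $ i $ i = 0) \<and> vector [1,1,1] \<bullet> (B *v vector [1,1,1]) = 0"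
  proof -
    have "{1..4} = {1, 2, 3, 4::nat}" by auto
    moreover have "B $ 1 $ 1 = a1\<^sup>2 * (x 1 \<bullet> (A *v x 1))" "B $ 2 $ 2 = a2\<^sup>2 * (x 2 \<bullet> (A *v x 2))"
      "B $ 3 $ 3 = a3\<^sup>2 * (x 3 \<bullet> (A *v x 3))"
      using form[of "axis 1 1"] form[of "axis 2 1"] form[of "axis 3 1"]
      unfolding x axis_form by (simp_all add: matrix_vector_mult_scaleR power2_eq_square)
    ultimately show ?thesis using a form[of "vector [1,1,1]"] by (simp add: forall_3 x)
  qed
  have tangent: "l \<bullet> (matrix_inv A *v l) = ?c \<bullet> (matrix_inv B *v ?c)" if "det A \<noteq> 0"
  proof -
    have "matrix_inv A = M ** matrix_inv B ** transpose M"
      unfolding B_def using that M by (intro matrix_inv_congruent) (auto simp: invertible_det_nz)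
    then have "matrix_inv A *v l = M *v (matrix_inv B *v ?c)"
      by (simp only: matrix_vector_mul_assoc matrix_mul_assoc)
    then show ?thesis using adjoint_dot[of M _ l] by (metis inner_commute)
  qed
  have param: "A = u *\<^sub>R pencil M t \<longleftrightarrow> B = u *\<^sub>R frame_conic t" for u t
  proof -
    have "u *\<^sub>R pencil M t = transpose ?N ** (u *\<^sub>R frame_conic t) ** ?N"
      by (simp add: pencil_def scalar_matrix_assoc matrix_scalar_ac)
    then show ?thesis using congruent_eq_iff[OF M, of A] B_def by metis
  qed
  show ?thesis
  proof
    assume L: "tangent_real_conic x l A"
    then have L': "transpose B = B" "det B \<noteq> 0" "\<And>i. B $ i $ i = 0"
        "vector [1,1,1] \<bullet> (B *v vector [1,1,1]) = 0" "?c \<bullet> (matrix_inv B *v ?c) = 0"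
      using sym det points tangent by (auto simp: tangent_real_conic_def)
    then obtain u t where ut: "u \<noteq> 0" "B = u *\<^sub>R frame_conic t"
      using frame_conic_complete by blast
    have "det B = u ^ 3 * det (frame_conic t)" by (simp add: ut det_3 algebra_simps power3_eq_cube)
    then have "t \<noteq> 0" "t \<noteq> - 1" using L'(2) by (auto simp: det_frame_conic)
    then have "t \<in> tangency_params ?c"
      using frame_tangency ut L'(5) by (auto simp: tangency_params_def)
    with ut show "\<exists>u t. u \<noteq> 0 \<and> t \<in> tangency_params ?c \<and> A = u *\<^sub>R pencil M t"
      using param by blast
  next
    assume "\<exists>u t. u \<noteq> 0 \<and> t \<in> tangency_params ?c \<and> A = u *\<^sub>R pencil M t"
    then obtain u t where ut: "u \<noteq> 0" "B = u *\<^sub>R frame_conic t" "t \<noteq> 0" "t \<noteq> - 1" "tangency_poly ?c t = 0"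
      using param by (auto simp: tangency_params_def)
    have "det B = u ^ 3 * det (frame_conic t)" by (simp add: ut det_3 algebra_simps power3_eq_cube)
    then have "det B \<noteq> 0" using ut by (simp add: det_frame_conic)
    moreover have "transpose B = B"
      by (simp add: ut vec_eq_iff forall_3 transpose_def frame_conic_def)
    moreover have "\<forall>i. B $ i $ i = 0" "vector [1,1,1] \<bullet> (B *v vector [1,1,1]) = 0"
      by (simp_all add: ut forall_3 frame_conic_def inner_vec_def sum_3 matrix_vector_mult_def algebra_simps)
    moreover have "?c \<bullet> (matrix_inv B *v ?c) = 0"
      using frame_tangency ut by auto
    ultimately show "tangent_real_conic x l A"
      using sym det points tangent by (auto simp: tangent_real_conic_def)
  qed
qed

section \<open>Counting the real solutions\<close>

lemma scale_rel_real: "u \<noteq> 0 \<Longrightarrow> (cmat A, cmat (u *\<^sub>R A)) \<in> scale_rel"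
  unfolding scale_rel_def
  by (auto simp: cmat_def vec_eq_iff intro!: exI[of _ "complex_of_real u"])

text \<open>Two members of the pencil that are proportional over the complex numbers agree, because
  their pullbacks to the frame both have the entry \<open>1\<close> at position (2,3).\<close>

lemma pencil_inj:
  assumes M: "invertible M" and rel: "(cmat (pencil M t), cmat (pencil M s)) \<in> scale_rel"
  shows "t = s"
proof -
  let ?S = "\<lambda>k. map_matrix ((*) k) :: complex^3^3 \<Rightarrow> complex^3^3"
  obtain k where k: "cmat (pencil M s) = ?S k (cmat (pencil M t))"
    using rel by (auto simp: scale_rel_def)
  have frame: "cmat (frame_conic t) = cmat (transpose M) ** cmat (pencil M t) ** cmat M" for t
    using congruent_eq_iff[OF M, of "pencil M t" "frame_conic t"]
    by (simp add: pencil_def cmat_mult)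
  have scale: "X ** ?S k Z ** Y = ?S k (X ** Z ** Y)" for X Y Z
    by (simp add: vec_eq_iff matrix_matrix_mult_def sum_distrib_left sum_distrib_right mult_ac)
  have E: "cmat (frame_conic s) = ?S k (cmat (frame_conic t))"
    unfolding frame k scale ..
  have "cmat (frame_conic s) $ 2 $ 3 = k * cmat (frame_conic t) $ 2 $ 3"
    "cmat (frame_conic s) $ 1 $ 3 = k * cmat (frame_conic t) $ 1 $ 3"
    unfolding E by simp_all
  then show ?thesis by (simp add: cmat_def frame_conic_def)
qed

lemma card_real_solutions:
  assumes M: "invertible M"
    and a: "a1 \<noteq> 0" "a2 \<noteq> 0" "a3 \<noteq> 0"
    and x: "M *v axis 1 1 = a1 *\<^sub>R x 1" "M *v axis 2 1 = a2 *\<^sub>R x 2" "M *v axis 3 1 = a3 *\<^sub>R x 3"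
      "M *v vector [1, 1, 1] = x 4"
  shows "card {K \<in> solutions x l. real_conic K} = card (tangency_params (transpose M *v l))"
proof -
  let ?cls = "\<lambda>A. scale_rel `` {cmat A}"
  let ?T = "tangency_params (transpose M *v l)"
  have same_class: "?cls (u *\<^sub>R A) = ?cls A" if "u \<noteq> 0" for u A
    using equiv_class_eq[OF equiv_scale_rel scale_rel_real[OF that]] by simp
  have iff: "tangent_real_conic x l A \<longleftrightarrow> (\<exists>u t. u \<noteq> 0 \<and> t \<in> ?T \<and> A = u *\<^sub>R pencil M t)" for A
    using tangent_real_conic_iff[where x = x, OF M a x] .
  have "{K \<in> solutions x l. real_conic K} = (\<lambda>t. ?cls (pencil M t)) ` ?T"
    unfolding real_solutions
  proof (intro equalityI subsetI)
    fix K assume "K \<in> ?cls ` {A. tangent_real_conic x l A}"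
    then show "K \<in> (\<lambda>t. ?cls (pencil M t)) ` ?T" using same_class by (auto simp: iff)
  next
    fix K assume "K \<in> (\<lambda>t. ?cls (pencil M t)) ` ?T"
    then obtain t where t: "t \<in> ?T" "K = ?cls (pencil M t)" by auto
    then have "tangent_real_conic x l (pencil M t)"
      unfolding iff by (metis scaleR_one zero_neq_one)
    with t show "K \<in> ?cls ` {A. tangent_real_conic x l A}" by blast
  qed
  moreover have "inj_on (\<lambda>t. ?cls (pencil M t)) ?T"
    using pencil_inj[OF M] eq_equiv_class[OF _ equiv_scale_rel] by (meson UNIV_I inj_onI)
  ultimately show ?thesis by (simp add: card_image)
qed

text \<open>The vanishing of \<open>c\<^sub>1 + c\<^sub>3\<close>, \<open>c\<^sub>1 + c\<^sub>2\<close> or \<open>c\<^sub>2 + c\<^sub>3\<close> moves a root of the tangency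
  polynomial to \<open>0\<close>, \<open>-1\<close> or \<open>\<infinity>\<close>; otherwise only the sign of the discriminant matters.  For
  the direction from left to right, two admissible roots determine the polynomial up to a factor
  by Vieta's formulas.\<close>

lemma card_tangency_params:
  assumes "c \<noteq> 0"
  shows "card (tangency_params c) = 2 \<longleftrightarrow>
    c$1 + c$2 \<noteq> 0 \<and> c$1 + c$3 \<noteq> 0 \<and> c$2 + c$3 \<noteq> 0 \<and>
    c$1 * c$2 * c$3 * (c$1 + c$2 + c$3) < 0" (is "_ \<longleftrightarrow> ?R")
proof -
  define p q r where pqr: "p = c$1" "q = c$2" "r = c$3"
  define b where "b = p * q - r * (p + q + r)"
  have T: "tangency_params c = {t. t \<noteq> 0 \<and> t \<noteq> - 1 \<and> (p + r)\<^sup>2 - 2 * b * t + (q + r)\<^sup>2 * t\<^sup>2 = 0}"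
    by (simp add: tangency_params_def tangency_poly_def pqr b_def)
  have disc: "b\<^sup>2 - (p + r)\<^sup>2 * (q + r)\<^sup>2 = - 4 * (p * q * r * (p + q + r))"
    by (simp add: b_def power2_eq_square algebra_simps)
  have at_m1: "(p + r)\<^sup>2 + 2 * b + (q + r)\<^sup>2 = (p + q)\<^sup>2"
    by (simp add: b_def power2_eq_square algebra_simps)
  have R: "?R \<longleftrightarrow> p + q \<noteq> 0 \<and> p + r \<noteq> 0 \<and> q + r \<noteq> 0 \<and> b\<^sup>2 - (p + r)\<^sup>2 * (q + r)\<^sup>2 > 0"
    unfolding disc by (simp add: pqr mult.assoc)
  show ?thesis unfolding R
  proof
    assume "card (tangency_params c) = 2"
    then obtain t s where ts: "t \<noteq> s" "tangency_params c = {t, s}" by (auto simp: card_2_iff)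
    then have "t \<in> tangency_params c" "s \<in> tangency_params c" by auto
    then have t: "t \<noteq> 0" "t \<noteq> - 1" "(p + r)\<^sup>2 - 2 * b * t + (q + r)\<^sup>2 * t\<^sup>2 = 0"
      and s: "s \<noteq> 0" "s \<noteq> - 1" "(p + r)\<^sup>2 - 2 * b * s + (q + r)\<^sup>2 * s\<^sup>2 = 0"
      by (auto simp: T)
    \<comment> \<open>Vieta's formulas, free of division because the leading coefficient might still vanish\<close>
    have "(t - s) * ((q + r)\<^sup>2 * (t + s) - 2 * b) = 0"
      using t(3) s(3) by (simp add: power2_eq_square algebra_simps)
    then have sum: "2 * b = (q + r)\<^sup>2 * (t + s)" using ts by simp
    have prod: "(p + r)\<^sup>2 = (q + r)\<^sup>2 * (t * s)"
      using t(3) unfolding sum by (simp add: power2_eq_square algebra_simps)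
    have qr: "q + r \<noteq> 0"
    proof
      assume "q + r = 0"
      then have "p + r = 0" "b = 0" "q = - r" using sum prod by auto
      then have "p = - r" "q = - r" "2 * r\<^sup>2 = 0" by (auto simp: b_def power2_eq_square)
      then have "c = 0" using pqr by (simp add: vec_eq_iff forall_3)
      with assms show False by simp
    qed
    have pr: "p + r \<noteq> 0" using prod qr t s by auto
    have "(p + q)\<^sup>2 = (q + r)\<^sup>2 * ((1 + t) * (1 + s))"
      unfolding at_m1[symmetric] sum prod by (simp add: algebra_simps)
    then have pq: "p + q \<noteq> 0" using qr t s by auto
    have "4 * (b\<^sup>2 - (p + r)\<^sup>2 * (q + r)\<^sup>2) = (2 * b)\<^sup>2 - 4 * (p + r)\<^sup>2 * (q + r)\<^sup>2"
      by (simp add: power2_eq_square)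
    also have "\<dots> = ((q + r)\<^sup>2 * (t - s))\<^sup>2"
      unfolding sum prod by (simp add: power2_eq_square algebra_simps)
    finally have "4 * (b\<^sup>2 - (p + r)\<^sup>2 * (q + r)\<^sup>2) = ((q + r)\<^sup>2 * (t - s))\<^sup>2" .
    moreover have "((q + r)\<^sup>2 * (t - s))\<^sup>2 > 0" using qr ts by simp
    ultimately have "4 * (b\<^sup>2 - (p + r)\<^sup>2 * (q + r)\<^sup>2) > 0" by metis
    then have "b\<^sup>2 - (p + r)\<^sup>2 * (q + r)\<^sup>2 > 0" by (rule zero_less_mult_pos) simp
    then show "p + q \<noteq> 0 \<and> p + r \<noteq> 0 \<and> q + r \<noteq> 0 \<and> b\<^sup>2 - (p + r)\<^sup>2 * (q + r)\<^sup>2 > 0"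
      using pq pr qr by blast
  next
    assume R: "p + q \<noteq> 0 \<and> p + r \<noteq> 0 \<and> q + r \<noteq> 0 \<and> b\<^sup>2 - (p + r)\<^sup>2 * (q + r)\<^sup>2 > 0"
    define d where "d = sqrt (b\<^sup>2 - (p + r)\<^sup>2 * (q + r)\<^sup>2)"
    have d: "d > 0" "d\<^sup>2 = b\<^sup>2 - (p + r)\<^sup>2 * (q + r)\<^sup>2" using R by (auto simp: d_def)
    let ?m = "(q + r)\<^sup>2"
    have m: "?m > 0" using R by simp
    have root: "(p + r)\<^sup>2 - 2 * b * t + ?m * t\<^sup>2 = 0 \<longleftrightarrow> t = (b + d) / ?m \<or> t = (b - d) / ?m" for t
    proof -
      \<comment> \<open>completing the square\<close>
      have "(p + r)\<^sup>2 - 2 * b * t + ?m * t\<^sup>2 = 0 \<longleftrightarrow>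
          ?m * ((p + r)\<^sup>2 - 2 * b * t + ?m * t\<^sup>2) = 0" using m by simp
      also have "?m * ((p + r)\<^sup>2 - 2 * b * t + ?m * t\<^sup>2) = (?m * t - b)\<^sup>2 - d\<^sup>2"
        unfolding d(2) by (simp add: power2_eq_square algebra_simps)
      also have "\<dots> = (?m * t - b - d) * (?m * t - b + d)"
        by (simp add: power2_eq_square algebra_simps)
      finally have "(p + r)\<^sup>2 - 2 * b * t + ?m * t\<^sup>2 = 0 \<longleftrightarrow>
          ?m * t = b + d \<or> ?m * t = b - d" by auto
      moreover have "?m * t = k \<longleftrightarrow> t = k / ?m" for k
        using m by (metis less_irrefl nonzero_mult_div_cancel_left nonzero_mult_div_cancel_left times_divide_eq_right)
      ultimately show ?thesis by blast
    qed
    have "t \<noteq> 0 \<and> t \<noteq> - 1" if "(p + r)\<^sup>2 - 2 * b * t + ?m * t\<^sup>2 = 0" for t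
    proof (intro conjI notI)
      assume "t = 0" then show False using that R by simp
    next
      assume "t = - 1" then show False using that R at_m1 by simp
    qed
    then have "tangency_params c = {(b + d) / ?m, (b - d) / ?m}"
      unfolding T using root by blast
    moreover have "(b + d) / ?m \<noteq> (b - d) / ?m" using m d by simp
    ultimately show "card (tangency_params c) = 2" by simp
  qed
qed

section \<open>Coordinates for a quadrangle\<close>

text \<open>A nonzero kernel vector of the matrix with rows \<open>p\<close>, \<open>q\<close>, \<open>r\<close> is a line through the three
  points.\<close>

lemma det_nz_of_not_collinear:
  assumes "\<not> proj_collinear p q r"
  shows "det (column_matrix p q r) \<noteq> 0"
proof
  assume "det (column_matrix p q r) = 0"
  then have "\<not> invertible (vector [p, q, r] :: real^3^3)"
    by (simp add: column_matrix_def invertible_det_nz)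
  then obtain m where "m \<noteq> 0" "(vector [p, q, r] :: real^3^3) *v m = 0"
    using invertible_left_inverse matrix_left_invertible_ker by metis
  then have "proj_collinear p q r"
    unfolding proj_collinear_def lies_on_def
    by (auto simp: vec_eq_iff forall_3 matrix_vector_mult_def inner_vec_def)
  with assms show False by simp
qed

lemma column_matrix_mv: "column_matrix p q r *v v = v$1 *\<^sub>R p + v$2 *\<^sub>R q + v$3 *\<^sub>R r"
  by (simp add: column_matrix_def vec_eq_iff matrix_vector_mult_def sum_3 transpose_def mult.commute)

lemma det_column_matrix: "det (column_matrix p q r) = cross3 p q \<bullet> r"
  by (simp add: column_matrix_def det_3 transpose_def cross3_def inner_vec_def sum_3 algebra_simps)

lemma det_column_scale:
  "det (column_matrix (a *\<^sub>R p) (b *\<^sub>R q) (c *\<^sub>R r)) = a * b * c * det (column_matrix p q r)"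
  by (simp add: det_column_matrix cross3_def inner_vec_def sum_3 algebra_simps)

text \<open>Cramer's rule for the coordinates of a fourth point.\<close>

lemma det_column_combination:
  fixes p q r :: "real^3" and a b c :: real
  defines "s \<equiv> a *\<^sub>R p + b *\<^sub>R q + c *\<^sub>R r"
  shows "det (column_matrix p q s) = c * det (column_matrix p q r)"
    and "det (column_matrix p r s) = - b * det (column_matrix p q r)"
    and "det (column_matrix q r s) = a * det (column_matrix p q r)"
  unfolding s_def by (simp_all add: det_column_matrix cross3_def inner_vec_def sum_3 algebra_simps)

text \<open>A diagonal vertex is the intersection of two opposite sides.  From
  \<open>x\<^sub>4 = a x\<^sub>1 + b x\<^sub>2 + c x\<^sub>3\<close> one reads off, for instance, that \<open>a x\<^sub>1 + b x\<^sub>2 = x\<^sub>4 - c x\<^sub>3\<close> lies on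
  both \<open>x\<^sub>1x\<^sub>2\<close> and \<open>x\<^sub>3x\<^sub>4\<close>.\<close>

lemma diag_vertex_combination:
  fixes x :: "nat \<Rightarrow> real^3" and a b c :: real
  defines "D \<equiv> det (column_matrix (x 1) (x 2) (x 3))"
  assumes "x 4 = a *\<^sub>R x 1 + b *\<^sub>R x 2 + c *\<^sub>R x 3"
  shows "diag_vertex x 1 = (- D) *\<^sub>R (a *\<^sub>R x 1 + b *\<^sub>R x 2)"
    and "diag_vertex x 2 = D *\<^sub>R (a *\<^sub>R x 1 + c *\<^sub>R x 3)"
    and "diag_vertex x 3 = D *\<^sub>R (b *\<^sub>R x 2 + c *\<^sub>R x 3)"
  unfolding diag_vertex_def D_def
  by (simp_all add: assms(2) det_column_matrix cross3_def inner_vec_def sum_3 vec_eq_iff forall_3 algebra_simps)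

section \<open>Sign patterns of four numbers\<close>

lemma prod_pos_iff_even:
  fixes g :: "'i \<Rightarrow> 'a::linordered_idom"
  assumes "finite I" "\<forall>i\<in>I. g i \<noteq> 0"
  shows "prod g I > 0 \<longleftrightarrow> even (card {i\<in>I. g i < 0})"
  using assms
proof (induction I rule: finite_induct)
  case empty
  then show ?case by simp
next
  case (insert i I)
  have nz: "prod g I \<noteq> 0" using insert by simp
  have "{j \<in> insert i I. g j < 0} = (if g i < 0 then insert i {j\<in>I. g j < 0} else {j\<in>I. g j < 0})"
    by auto
  then have "even (card {j \<in> insert i I. g j < 0}) \<longleftrightarrow> (g i < 0 \<longleftrightarrow> odd (card {j\<in>I. g j < 0}))"
    using insert by simp
  also have "\<dots> \<longleftrightarrow> (g i < 0 \<longleftrightarrow> prod g I < 0)"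
    using insert nz by (metis insertCI linorder_neqE not_less_iff_gr_or_eq)
  also have "\<dots> \<longleftrightarrow> prod g (insert i I) > 0"
    using insert nz by (auto simp: zero_less_mult_iff)
  finally show ?case by simp
qed

lemma all_agree_iff:
  assumes "finite I" and P: "\<forall>i\<in>I. \<forall>j\<in>I. f i = f j \<longleftrightarrow> (P i \<longleftrightarrow> P j)"
  shows "all_agree f I \<longleftrightarrow> card {i\<in>I. P i} = 0 \<or> card {i\<in>I. P i} = card I"
proof -
  have "card {i\<in>I. P i} = card I \<longleftrightarrow> {i\<in>I. P i} = I"
    using assms(1) by (metis (no_types, lifting) card_subset_eq mem_Collect_eq subsetI)
  moreover have "card {i\<in>I. P i} = 0 \<longleftrightarrow> {i\<in>I. P i} = {}" using assms(1) by simp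
  ultimately show ?thesis unfolding all_agree_def using P by blast
qed

text \<open>A function with two values, distinguished by the predicate \<open>P\<close>, can only split a set along
  \<open>P\<close>; positivity of both sizes is needed for the two parts to carry different values.\<close>

lemma splits_iff:
  assumes "finite I" and P: "\<forall>i\<in>I. \<forall>j\<in>I. f i = f j \<longleftrightarrow> (P i \<longleftrightarrow> P j)"
    and ab: "a + b = card I" "a > 0" "b > 0"
  shows "splits a b f I \<longleftrightarrow> card {i\<in>I. P i} = a \<or> card {i\<in>I. P i} = b"
proof
  assume "splits a b f I"
  then obtain A B where AB: "A \<union> B = I" "A \<inter> B = {}" "card A = a" "card B = b"
      "all_agree f A" "all_agree f B" "\<forall>i\<in>A. \<forall>j\<in>B. f i \<noteq> f j"
    unfolding splits_def by auto
  obtain i j where ij: "i \<in> A" "j \<in> B" using AB ab by (metis card_gt_0_iff equals0I)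
  have "f k = f i" if "k \<in> A" for k using AB that ij unfolding all_agree_def by blast
  then have PA: "P k \<longleftrightarrow> P i" if "k \<in> A" for k using AB that ij P by blast
  have PB: "P k \<longleftrightarrow> \<not> P i" if "k \<in> B" for k using AB that ij P by blast
  have "{i\<in>I. P i} = (if P i then A else B)" using PA PB AB by auto
  then show "card {i\<in>I. P i} = a \<or> card {i\<in>I. P i} = b" using AB by simp
next
  let ?Y = "{i\<in>I. P i}" and ?N = "{i\<in>I. \<not> P i}"
  have N: "card ?Y + card ?N = card I"
    using card_Int_Diff[OF assms(1), of "{i. P i}"] by (simp add: Int_def set_diff_eq)
  have Y: "all_agree f ?Y" "all_agree f ?N" "\<forall>i\<in>?Y. \<forall>j\<in>?N. f i \<noteq> f j" "\<forall>i\<in>?N. \<forall>j\<in>?Y. f i \<noteq> f j"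
    using P unfolding all_agree_def by blast+
  assume "card ?Y = a \<or> card ?Y = b"
  then show "splits a b f I"
  proof
    assume "card ?Y = a"
    then show ?thesis unfolding splits_def using Y N ab
      by (intro exI[of _ ?Y] exI[of _ ?N]) auto
  next
    assume "card ?Y = b"
    then show ?thesis unfolding splits_def using Y N ab
      by (intro exI[of _ ?N] exI[of _ ?Y]) auto
  qed
qed

text \<open>The function \<open>f\<close> stands for any two-valued record of the sign of \<open>g\<close>, such as the direction
  of a triple or the side of a point.  Among the possible numbers 0 to 4 of negative values, the
  even ones give the patterns 4+0 and 2+2, the odd ones the pattern 3+1.\<close>

lemma sign_pattern_iff:
  fixes g :: "'i \<Rightarrow> 'a::linordered_idom"
  assumes I: "finite I" "card I = 4" and g: "\<forall>i\<in>I. g i \<noteq> 0"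
    and f: "\<forall>i\<in>I. \<forall>j\<in>I. f i = f j \<longleftrightarrow> (g i < 0 \<longleftrightarrow> g j < 0)"
  shows "all_agree f I \<or> splits 2 2 f I \<longleftrightarrow> prod g I > 0"
    and "splits 3 1 f I \<longleftrightarrow> prod g I < 0"
proof -
  let ?n = "card {i\<in>I. g i < 0}"
  have "?n \<le> 4" using card_mono[OF I(1), of "{i\<in>I. g i < 0}"] I by auto
  then have n: "?n = 0 \<or> ?n = 1 \<or> ?n = 2 \<or> ?n = 3 \<or> ?n = 4" by arith
  have nz: "prod g I \<noteq> 0" using I g by simp
  have agree: "all_agree f I \<longleftrightarrow> ?n = 0 \<or> ?n = 4"
    using all_agree_iff[OF I(1) f] I(2) by simp
  have split: "splits a b f I \<longleftrightarrow> ?n = a \<or> ?n = b" if "a + b = 4" "a > 0" "b > 0" for a b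
    using splits_iff[OF I(1) f] that I(2) by simp
  have pos: "prod g I > 0 \<longleftrightarrow> even ?n" by (rule prod_pos_iff_even[OF I(1) g])
  then have neg: "prod g I < 0 \<longleftrightarrow> odd ?n" using nz by linarith
  show "all_agree f I \<or> splits 2 2 f I \<longleftrightarrow> prod g I > 0"
    unfolding agree pos using split[of 2 2] n by (elim disjE) simp_all
  show "splits 3 1 f I \<longleftrightarrow> prod g I < 0"
    unfolding neg using split[of 3 1] n by (elim disjE) simp_all
qed

section \<open>Existence of two real solutions\<close>

theorem proposition2:
  fixes x :: "nat \<Rightarrow> real^3" and l :: "real^3"
  assumes "\<forall>i\<in>{1..4}. finite_point (x i)"
    and "l \<noteq> 0"
    and "general_position x l"
  shows "card {K \<in> solutions x l. real_conic K} = 2 \<longleftrightarrow>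
    (\<forall>i\<in>{1..4}. \<not> lies_on (x i) l) \<and>
    (\<forall>k\<in>{1..3}. \<not> lies_on (diag_vertex x k) l) \<and>
    ((all_agree (dir x) triples \<or> splits 2 2 (dir x) triples) \<and>
     (all_agree (\<lambda>i. side l (x i)) {1..4} \<or> splits 2 2 (\<lambda>i. side l (x i)) {1..4})
     \<or>
     splits 3 1 (dir x) triples \<and> splits 3 1 (\<lambda>i. side l (x i)) {1..4})"
proof -
  have four: "{1..4} = {1, 2, 3, 4::nat}" and three: "{1..3} = {1, 2, 3::nat}" by auto
  define g where "g = (\<lambda>(i, j, k). det (column_matrix (x i) (x j) (x k)))"
  define s where "s i = x i \<bullet> l" for i
  define D where "D = g (1, 2, 3)"
  have det_nz: "\<forall>\<tau>\<in>triples. g \<tau> \<noteq> 0"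
    using assms(3) det_nz_of_not_collinear
    by (auto simp: triples_def g_def general_position_def four)
  then have D: "D \<noteq> 0" by (simp add: D_def triples_def)

  let ?P = "column_matrix (x 1) (x 2) (x 3)"
  define v where "v = matrix_inv ?P *v x 4"
  have "?P *v v = x 4"
    using D by (simp add: v_def matrix_vector_mul_assoc matrix_inv_cancel invertible_det_nz D_def g_def)
  then obtain a b c where x4: "x 4 = a *\<^sub>R x 1 + b *\<^sub>R x 2 + c *\<^sub>R x 3"
    by (metis column_matrix_mv)
  have g: "g (1, 2, 4) = c * D" "g (1, 3, 4) = - b * D" "g (2, 3, 4) = a * D"
    by (simp_all add: g_def D_def x4 det_column_combination del: One_nat_def)
  have abc: "a \<noteq> 0" "b \<noteq> 0" "c \<noteq> 0"
    using det_nz g by (auto simp: triples_def)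

  define M where "M = column_matrix (a *\<^sub>R x 1) (b *\<^sub>R x 2) (c *\<^sub>R x 3)"
  have M: "invertible M"
    using abc D by (simp add: M_def invertible_det_nz det_column_scale D_def g_def)
  have columns: "M *v axis 1 1 = a *\<^sub>R x 1" "M *v axis 2 1 = b *\<^sub>R x 2" "M *v axis 3 1 = c *\<^sub>R x 3"
      "M *v vector [1, 1, 1] = x 4"
    by (simp_all add: M_def column_matrix_mv x4 axis_def)
  define w where "w = transpose M *v l"
  have w: "w $ 1 = a * s 1" "w $ 2 = b * s 2" "w $ 3 = c * s 3"
    by (simp_all add: w_def M_def column_matrix_def s_def matrix_vector_mult_def inner_vec_def sum_3
        algebra_simps)
  have s4: "s 4 = w $ 1 + w $ 2 + w $ 3" by (simp add: w s_def x4 inner_add_left)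
  \<comment> \<open>\<^term>\<open>transpose M\<close> is injective, as its kernel is orthogonal to the range of \<^term>\<open>M\<close>\<close>
  have "w \<noteq> 0"
  proof
    assume "w = 0"
    then have "(M *v (matrix_inv M *v l)) \<bullet> l = 0" unfolding adjoint_dot w_def by simp
    then show False using M assms(2) by (simp add: matrix_vector_mul_assoc matrix_inv_cancel)
  qed
  then have card: "card {K \<in> solutions x l. real_conic K} = 2 \<longleftrightarrow>
      w$1 + w$2 \<noteq> 0 \<and> w$1 + w$3 \<noteq> 0 \<and> w$2 + w$3 \<noteq> 0 \<and>
      w$1 * w$2 * w$3 * (w$1 + w$2 + w$3) < 0"
    unfolding card_real_solutions[where x = x, OF M abc columns] w_def
    by (rule card_tangency_params)

  have diag: "(\<forall>k\<in>{1..3}. \<not> lies_on (diag_vertex x k) l) \<longleftrightarrow>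
      w$1 + w$2 \<noteq> 0 \<and> w$1 + w$3 \<noteq> 0 \<and> w$2 + w$3 \<noteq> 0"
    using D unfolding three
    by (auto simp: lies_on_def diag_vertex_combination[OF x4] w s_def inner_add_left D_def g_def
        simp del: One_nat_def)

  have prod_det: "prod g triples = - (a * b * c) * D ^ 4"
    by (simp add: triples_def g D_def[symmetric] power4_eq_xxxx del: One_nat_def)
  have prod_side: "prod s {1..4} = s 1 * s 2 * s 3 * s 4"
    unfolding four by simp
  have "prod g triples * prod s {1..4} = - (w$1 * w$2 * w$3 * (w$1 + w$2 + w$3)) * D ^ 4"
    unfolding prod_det prod_side s4 by (simp add: w)
  moreover have "D ^ 4 > 0" using D by simp
  ultimately have sign: "w$1 * w$2 * w$3 * (w$1 + w$2 + w$3) < 0 \<longleftrightarrow>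
      prod g triples * prod s {1..4} > 0"
    by (simp add: zero_less_mult_iff mult_less_0_iff)

  have "card triples = 4" "finite triples" by (simp_all add: triples_def)
  moreover have "\<forall>\<sigma>\<in>triples. \<forall>\<tau>\<in>triples. dir x \<sigma> = dir x \<tau> \<longleftrightarrow> (g \<sigma> < 0 \<longleftrightarrow> g \<tau> < 0)"
    by (auto simp: g_def split: if_splits)
  ultimately have dirs:
      "all_agree (dir x) triples \<or> splits 2 2 (dir x) triples \<longleftrightarrow> prod g triples > 0"
      "splits 3 1 (dir x) triples \<longleftrightarrow> prod g triples < 0"
    using sign_pattern_iff[of triples g "dir x"] det_nz by blast+
  have sides: "all_agree (\<lambda>i. side l (x i)) {1..4} \<or> splits 2 2 (\<lambda>i. side l (x i)) {1..4}
        \<longleftrightarrow> prod s {1..4} > 0"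
      "splits 3 1 (\<lambda>i. side l (x i)) {1..4} \<longleftrightarrow> prod s {1..4} < 0"
    if nz: "\<forall>i\<in>{1..4}. s i \<noteq> 0"
  proof -
    have "\<forall>i\<in>{1..4}. \<forall>j\<in>{1..4}. side l (x i) = side l (x j) \<longleftrightarrow> (s i < 0 \<longleftrightarrow> s j < 0)"
      using nz by (auto simp: side_def sgn_if s_def)
    then show "all_agree (\<lambda>i. side l (x i)) {1..4} \<or> splits 2 2 (\<lambda>i. side l (x i)) {1..4}
        \<longleftrightarrow> prod s {1..4} > 0"
      "splits 3 1 (\<lambda>i. side l (x i)) {1..4} \<longleftrightarrow> prod s {1..4} < 0"
      using sign_pattern_iff[of "{1..4}" s "\<lambda>i. side l (x i)"] nz by simp_all
  qed
  have on: "(\<forall>i\<in>{1..4}. \<not> lies_on (x i) l) \<longleftrightarrow> (\<forall>i\<in>{1..4}. s i \<noteq> 0)"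
    by (simp add: lies_on_def s_def)
  \<comment> \<open>If a point lies on the line, both sides of the equivalence fail: the discriminant vanishes.\<close>
  show ?thesis
  proof (cases "\<forall>i\<in>{1..4}. s i \<noteq> 0")
    case True
    then show ?thesis
      unfolding card diag on sign dirs sides[OF True] zero_less_mult_iff by blast
  next
    case False
    then have "prod s {1..4} = 0" by (simp add: prod_zero_iff)
    then have "\<not> prod g triples * prod s {1..4} > 0"
      by (metis mult_zero_right less_irrefl)
    with False show ?thesis unfolding card on sign by blast
  qed
qed

end
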